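(* Let $n \ge 3$, let $G=C_n$ be the cycle of order $n$, and let $\sigma: V(G_1) \rightarrow V(G_2)$ be a bijection. Then $2 \le \dim(C(C_n, \sigma)) \le n-1$, and both bounds are attained (for suitable $n$ and $\sigma$).
   Context: For a connected graph $H$, a set $S \subseteq V(H)$ is a resolving set if for every two distinct vertices $x,y$ of $H$ there is $s \in S$ with $d_H(x,s) \neq d_H(y,s)$; the metric dimension $\dim(H)$ is the minimum cardinality of a resolving set of $H$. Given a graph $G$, let $G_1$ and $G_2$ be disjoint copies of $G$ and let $f: V(G_1)\to V(G_2)$ be a function. The functigraph $C(G,f)$ is the graph with vertex set $V(G_1)\cup V(G_2)$ and edge set $E(G_1)\cup E(G_2)\cup\{uv \mid u \in V(G_1),\ v=f(u)\}$. *)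

theory Defs
  imports "Graph_Theory.Graph_Theory"
begin

text \<open>
  Graphs are those of \<open>Graph_Theory\<close>: a finite simple graph is a \<open>pair_graph\<close>, i.e. a finite,
  symmetric, loop-free set of arcs in which an undirected edge \<open>uv\<close> is the pair of arcs
  \<open>(u, v)\<close>, \<open>(v, u)\<close>.
\<close>

text \<open>The shortest-path distance of the library, with every arc weighted \<open>1\<close>.\<close>

definition graph_dist :: "('a, 'b) pre_digraph \<Rightarrow> 'a \<Rightarrow> 'a \<Rightarrow> ereal" where
  "graph_dist H u v = wf_digraph.\<mu> H (\<lambda>_. 1) u v"

lemma (in wf_digraph) graph_dist_conv_length:
  "graph_dist G u v = (INF p \<in> {p. awalk u p v}. ereal (real (length p)))"
proof -
  have "awalk_cost (\<lambda>_. 1) p = real (length p)" for p :: "'b list"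
    by (induction p) auto
  then show ?thesis
    by (simp add: graph_dist_def \<mu>_def)
qed

definition resolving_set :: "('a, 'b) pre_digraph \<Rightarrow> 'a set \<Rightarrow> bool" where
  "resolving_set H S \<longleftrightarrow> S \<subseteq> verts H \<and>
    (\<forall>x \<in> verts H. \<forall>y \<in> verts H. x \<noteq> y \<longrightarrow> (\<exists>s \<in> S. graph_dist H x s \<noteq> graph_dist H y s))"

text \<open>
  Finiteness of \<open>S\<close> is automatic in a finite graph; it is there because the cardinality of an
  infinite set is \<open>0\<close> in HOL.
\<close>

definition metric_dimension :: "('a, 'b) pre_digraph \<Rightarrow> nat" where
  "metric_dimension H = (LEAST k. \<exists>S. resolving_set H S \<and> finite S \<and> card S = k)"

text \<open>
  The two disjoint copies of \<open>G\<close> are tagged by \<open>Inl\<close> and \<open>Inr\<close>, so that a function from the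
  vertices of the first copy to those of the second is a map \<open>f\<close> from \<open>pverts G\<close> to itself.
\<close>

definition functigraph :: "'a pair_pre_digraph \<Rightarrow> ('a \<Rightarrow> 'a) \<Rightarrow> ('a + 'a) pair_pre_digraph" where
  "functigraph G f =
    \<lparr> pverts = pverts G <+> pverts G,
      parcs = {(Inl u, Inl v) | u v. (u, v) \<in> parcs G}
            \<union> {(Inr u, Inr v) | u v. (u, v) \<in> parcs G}
            \<union> {(Inl u, Inr (f u)) | u. u \<in> pverts G}
            \<union> {(Inr (f u), Inl u) | u. u \<in> pverts G} \<rparr>"

text \<open>The cycle of order \<open>n\<close>; only meaningful for \<open>n \<ge> 3\<close>.\<close>

definition cycle_graph :: "nat \<Rightarrow> nat pair_pre_digraph" where
  "cycle_graph n =
    \<lparr> pverts = {..<n},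
      parcs = {(i, j). i < n \<and> j < n \<and> (j = Suc i mod n \<or> i = Suc j mod n)} \<rparr>"

lemma pair_graph_cycle_graph:
  assumes "n \<ge> 3"
  shows "pair_graph (cycle_graph n)"
proof
  have "parcs (cycle_graph n) \<subseteq> {..<n} \<times> {..<n}"
    by (auto simp: cycle_graph_def)
  then show "finite (parcs (cycle_graph n))"
    by (rule finite_subset) simp
  show "symmetric (with_proj (cycle_graph n))"
    by (auto simp: symmetric_def cycle_graph_def intro!: symI)
qed (use assms in \<open>auto simp: cycle_graph_def mod_Suc split: if_splits\<close>)

lemma pair_graph_functigraph:
  assumes "pair_graph G" and f: "f ` pverts G \<subseteq> pverts G"
  shows "pair_graph (functigraph G f)"
proof -
  interpret G: pair_graph G by fact
  show ?thesis
  proof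
    have "parcs (functigraph G f) \<subseteq> (pverts G <+> pverts G) \<times> (pverts G <+> pverts G)"
      using f by (auto simp: functigraph_def dest: G.in_arcsD1 G.in_arcsD2)
    then show "finite (parcs (functigraph G f))"
      by (rule finite_subset) (simp add: G.pair_finite_verts)
    show "symmetric (with_proj (functigraph G f))"
      using G.pair_sym_arcs by (auto simp: symmetric_def functigraph_def intro!: symI dest: symD)
  qed (use f in \<open>auto simp: functigraph_def G.pair_finite_verts
        dest: G.in_arcsD1 G.in_arcsD2 G.pair_no_loops\<close>)
qed

lemma connected_functigraph_cycle_graph:
  assumes n: "n \<ge> 3" and f: "f ` pverts (cycle_graph n) \<subseteq> pverts (cycle_graph n)"
  shows "connected (with_proj (functigraph (cycle_graph n) f))"
proof -
  let ?H = "functigraph (cycle_graph n) f"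
  interpret H: pair_graph ?H
    using pair_graph_functigraph[OF pair_graph_cycle_graph[OF n] f] .
  have V: "pverts ?H = {..<n} <+> {..<n}"
    by (simp add: functigraph_def cycle_graph_def)
  have l: "i < n \<Longrightarrow> Inl 0 \<rightarrow>\<^sup>*\<^bsub>with_proj ?H\<^esub> Inl i" for i
  proof (induction i)
    case 0
    then show ?case by (intro H.reachable_refl) (auto simp: V)
  next
    case (Suc i)
    moreover have "(Inl i, Inl (Suc i)) \<in> parcs ?H"
      using Suc.prems by (auto simp: functigraph_def cycle_graph_def)
    ultimately show ?case by (auto intro: H.reachable_adj_trans)
  qed
  have r: "i < n \<Longrightarrow> Inr 0 \<rightarrow>\<^sup>*\<^bsub>with_proj ?H\<^esub> Inr i" for i
  proof (induction i)
    case 0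
    then show ?case by (intro H.reachable_refl) (auto simp: V)
  next
    case (Suc i)
    moreover have "(Inr i, Inr (Suc i)) \<in> parcs ?H"
      using Suc.prems by (auto simp: functigraph_def cycle_graph_def)
    ultimately show ?case by (auto intro: H.reachable_adj_trans)
  qed
  have f0: "f 0 < n"
    using f n by (auto simp: cycle_graph_def image_subset_iff)
  have "Inl 0 \<rightarrow>\<^sup>*\<^bsub>with_proj ?H\<^esub> Inr (f 0)"
    using n by (intro H.reachable_adjI) (auto simp: functigraph_def cycle_graph_def)
  moreover have "Inr (f 0) \<rightarrow>\<^sup>*\<^bsub>with_proj ?H\<^esub> Inr 0"
    using r[OF f0] H.symmetric_reachable' by blast
  ultimately have all: "Inl 0 \<rightarrow>\<^sup>*\<^bsub>with_proj ?H\<^esub> v" if "v \<in> pverts ?H" for v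
    using that l r by (auto simp: V intro: H.reachable_trans)
  show ?thesis
    unfolding connected_def
  proof (rule strongly_connectedI)
    show "verts (with_proj (mk_symmetric (with_proj ?H))) \<noteq> {}"
      using n by (auto simp: V mk_symmetric_def lessThan_empty_iff)
    fix u v assume "u \<in> verts (with_proj (mk_symmetric (with_proj ?H)))"
      "v \<in> verts (with_proj (mk_symmetric (with_proj ?H)))"
    then have "u \<rightarrow>\<^sup>*\<^bsub>with_proj ?H\<^esub> v"
      using all[of u] all[of v] H.symmetric_reachable'
      by (auto simp: mk_symmetric_def intro: H.reachable_trans)
    then show "u \<rightarrow>\<^sup>*\<^bsub>with_proj (mk_symmetric (with_proj ?H))\<^esub> v"
      by (rule wf_digraph.reachable_mk_symmetricI[OF H.wf_digraph])
  qed
qed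

end

theory Submission
  imports Defs
begin

text \<open>
  Only distances \<open>0\<close> and \<open>1\<close> matter. Two neighbours of \<open>s\<close> are not told apart by \<open>s\<close>, and no
  vertex of the functigraph is a leaf, so a single vertex never resolves. Conversely the first
  copy with one vertex \<open>u\<close> removed resolves: a vertex of the second copy has exactly one neighbour
  in the first copy, these neighbours are pairwise different (so at most one of them is \<open>u\<close>), and
  \<open>u\<close> has two neighbours on its cycle. For \<open>n = 3\<close> the two bounds coincide.
\<close>

context wf_digraph
begin

lemma graph_dist_self:
  assumes "u \<in> verts G"
  shows "graph_dist G u u = 0"
proof (rule antisym)
  have "awalk u [] u"
    using assms by (simp add: awalk_Nil_iff)
  then show "graph_dist G u u \<le> 0"
    unfolding graph_dist_conv_length by (intro INF_lower2[of "[]"]) auto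
  show "0 \<le> graph_dist G u u"
    unfolding graph_dist_conv_length by (intro INF_greatest) auto
qed

lemma one_le_graph_dist:
  assumes "u \<noteq> v"
  shows "1 \<le> graph_dist G u v"
  unfolding graph_dist_conv_length
proof (rule INF_greatest)
  fix p assume "p \<in> {p. awalk u p v}"
  then have "p \<noteq> []"
    using assms by (auto simp: awalk_Nil_iff)
  then show "1 \<le> ereal (real (length p))"
    by (cases p) auto
qed

lemma graph_dist_eq_0_iff:
  assumes "u \<in> verts G"
  shows "graph_dist G u v = 0 \<longleftrightarrow> u = v"
  using graph_dist_self[OF assms] one_le_graph_dist[of u v] by (cases "u = v") auto

text \<open>An arc is a walk of length \<open>1\<close>. Without one, every walk between distinct
  vertices has at least two arcs, and this bound passes to the infimum. Distinctness matters because
  a loop at \<open>u\<close> would still give distance \<open>0\<close>.\<close>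

lemma graph_dist_eq_1_iff:
  assumes "u \<noteq> v"
  shows "graph_dist G u v = 1 \<longleftrightarrow> u \<rightarrow> v"
proof
  assume "u \<rightarrow> v"
  then obtain e where "awalk u [e] v"
    by (auto simp: arcs_ends_conv intro: arc_implies_awalk)
  then have "graph_dist G u v \<le> 1"
    unfolding graph_dist_conv_length by (intro INF_lower2[of "[e]"]) auto
  with one_le_graph_dist[OF assms] show "graph_dist G u v = 1"
    by simp
next
  assume dist: "graph_dist G u v = 1"
  show "u \<rightarrow> v"
  proof (rule ccontr)
    assume na: "\<not> u \<rightarrow> v"
    have "2 \<le> graph_dist G u v"
      unfolding graph_dist_conv_length
    proof (rule INF_greatest)
      fix p assume "p \<in> {p. awalk u p v}"
      then have p: "awalk u p v" by simp
      have "2 \<le> length p"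
      proof (cases p)
        case Nil
        with p assms show ?thesis by (auto simp: awalk_Nil_iff)
      next
        case (Cons e q)
        with p na show ?thesis
          by (cases q) (auto simp: awalk_Cons_iff awalk_Nil_iff arcs_ends_conv)
      qed
      then show "2 \<le> ereal (real (length p))" by simp
    qed
    with dist show False by simp
  qed
qed

end

lemma metric_dimension_le:
  assumes "resolving_set H S" "finite S"
  shows "metric_dimension H \<le> card S"
  unfolding metric_dimension_def using assms by (intro Least_le) blast

text \<open>Two in-neighbours of \<open>s\<close> are both at distance \<open>1\<close> from it, so
  no subset of \<open>{s}\<close> resolves. The set \<open>S\<close> guarantees that the
  \<open>LEAST\<close> in \<open>metric_dimension\<close> is attained.\<close>

lemma (in wf_digraph) two_le_metric_dimension:
  assumes ne: "verts G \<noteq> {}"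
    and nbrs: "\<And>s. s \<in> verts G \<Longrightarrow> \<exists>x y. x \<noteq> y \<and> x \<noteq> s \<and> y \<noteq> s \<and> x \<rightarrow> s \<and> y \<rightarrow> s"
    and res: "resolving_set G S" "finite S"
  shows "2 \<le> metric_dimension G"
proof -
  have "\<exists>T. resolving_set G T \<and> finite T \<and> card T = metric_dimension G"
    unfolding metric_dimension_def by (rule LeastI[of _ "card S"]) (use res in blast)
  then obtain T where T: "resolving_set G T" "finite T" "card T = metric_dimension G"
    by blast
  have "card T \<noteq> 0 \<and> card T \<noteq> 1"
  proof (rule ccontr)
    assume "\<not> (card T \<noteq> 0 \<and> card T \<noteq> 1)"
    then have "T = {} \<or> (\<exists>s. T = {s})"
      using T(2) by (auto simp: card_1_singleton_iff)
    \<comment> \<open>The empty set is treated together with the singletons: there \<open>s\<close>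
      is any vertex, supplied by \<open>ne\<close>.\<close>
    then obtain s where s: "T \<subseteq> {s}" "s \<in> verts G"
      using ne T(1) by (auto simp: resolving_set_def)
    from nbrs[OF s(2)] obtain x y
      where xy: "x \<noteq> y" "x \<noteq> s" "y \<noteq> s" "x \<rightarrow> s" "y \<rightarrow> s" by blast
    then have "graph_dist G x s = graph_dist G y s"
      by (metis graph_dist_eq_1_iff)
    moreover have "x \<in> verts G" "y \<in> verts G"
      using xy by auto
    ultimately show False
      using T(1) s(1) xy(1) unfolding resolving_set_def by blast
  qed
  then show ?thesis
    using T(3) by linarith
qed

lemma dominates_functigraph_iff:
  "Inl u \<rightarrow>\<^bsub>with_proj (functigraph G f)\<^esub> Inl v \<longleftrightarrow> (u, v) \<in> parcs G"
  "Inr u \<rightarrow>\<^bsub>with_proj (functigraph G f)\<^esub> Inr v \<longleftrightarrow> (u, v) \<in> parcs G"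
  "Inl u \<rightarrow>\<^bsub>with_proj (functigraph G f)\<^esub> Inr w \<longleftrightarrow> u \<in> pverts G \<and> w = f u"
  "Inr w \<rightarrow>\<^bsub>with_proj (functigraph G f)\<^esub> Inl u \<longleftrightarrow> u \<in> pverts G \<and> w = f u"
  by (auto simp: functigraph_def)

text \<open>For the lower bound every vertex needs two neighbours: this provides one on its own
  cycle, and the other is its partner in the opposite copy.\<close>

lemma cycle_graph_arc_Suc_mod:
  assumes "n \<ge> 3" "i < n"
  shows "(Suc i mod n, i) \<in> parcs (cycle_graph n)" "Suc i mod n \<noteq> i"
  using assms by (auto simp: cycle_graph_def mod_Suc)

text \<open>The vertex left out of the first copy is \<open>Inl 0\<close>. A member of the set is
  singled out by its distance \<open>0\<close> to itself; all other pairs are separated by adjacency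
  to some member.\<close>

lemma resolving_set_functigraph_cycle_graph:
  assumes n: "n \<ge> 3"
    and f: "bij_betw f (pverts (cycle_graph n)) (pverts (cycle_graph n))"
  shows "resolving_set (with_proj (functigraph (cycle_graph n) f)) (Inl ` {1..<n})"
    (is "resolving_set (with_proj ?F) ?S")
proof -
  let ?H = "with_proj ?F"
  have V: "pverts (cycle_graph n) = {..<n}"
    by (simp add: cycle_graph_def)
  have "f ` pverts (cycle_graph n) \<subseteq> pverts (cycle_graph n)"
    using f by (simp add: bij_betw_def)
  then interpret H: pair_graph "functigraph (cycle_graph n) f"
    using pair_graph_functigraph pair_graph_cycle_graph[OF n] by blast
  have verts: "pverts ?F = {..<n} <+> {..<n}"
    by (simp add: functigraph_def V)
  have arcs: "(0, 1) \<in> parcs (cycle_graph n)" "(0, n - 1) \<in> parcs (cycle_graph n)"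
    using n by (auto simp: cycle_graph_def)
  have eq0: "graph_dist ?H x s = 0 \<longleftrightarrow> x = s" if "x \<in> pverts ?F" for x s
    using H.graph_dist_eq_0_iff that by simp
  have eq1: "graph_dist ?H (Inr w) (Inl u) = 1 \<longleftrightarrow> u < n \<and> w = f u" for w u
    using H.graph_dist_eq_1_iff[of "Inr w" "Inl u"] dominates_functigraph_iff(4)[where w = w and u = u]
    by (simp add: V)
  have nbr0: "graph_dist ?H (Inl 0) (Inl u) = 1" if "u \<in> {1, n - 1}" for u
    using H.graph_dist_eq_1_iff[of "Inl 0" "Inl u"] dominates_functigraph_iff(1)[where u = 0 and v = u] that n arcs
    by auto
  have copy1: "\<exists>s\<in>?S. graph_dist ?H x s \<noteq> graph_dist ?H y s"
    if "x \<in> ?S" "x \<noteq> y" "y \<in> pverts ?F" for x y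
  proof -
    have "x \<in> pverts ?F"
      using that(1) by (auto simp: verts)
    then have "graph_dist ?H x x \<noteq> graph_dist ?H y x"
      using that eq0 by metis
    then show ?thesis
      using that(1) by blast
  qed
  \<comment> \<open>Otherwise \<open>Inr w\<close> would share with \<open>Inl 0\<close> the
    neighbours \<open>Inl 1\<close> and \<open>Inl (n - 1)\<close>, so \<open>f\<close> would take
    the value \<open>w\<close> at both. As \<open>n \<ge> 3\<close> makes \<open>1\<close> and
    \<open>n - 1\<close> distinct, injectivity forbids this.\<close>
  have mixed: "\<exists>s\<in>?S. graph_dist ?H (Inl 0) s \<noteq> graph_dist ?H (Inr w) s" for w
  proof (rule ccontr)
    assume "\<not> ?thesis"
    then have "graph_dist ?H (Inr w) (Inl 1) = 1" "graph_dist ?H (Inr w) (Inl (n - 1)) = 1"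
      using nbr0[of 1] nbr0[of "n - 1"] n by auto
    then have "f 1 = f (n - 1)"
      by (simp add: eq1)
    with f n show False
      by (auto simp: V bij_betw_def dest: inj_onD)
  qed
  have copy2: "\<exists>s\<in>?S. graph_dist ?H (Inr w) s \<noteq> graph_dist ?H (Inr w') s"
    if "w < n" "w' < n" "w \<noteq> w'" for w w'
  proof -
    obtain u u' where u: "u < n" "w = f u" "u' < n" "w' = f u'"
      using f \<open>w < n\<close> \<open>w' < n\<close> by (auto simp: V bij_betw_def) (metis imageE lessThan_iff)
    \<comment> \<open>The preimages differ, so at most one of them is \<open>0\<close>. A nonzero
      one gives a member of the set adjacent to exactly one of \<open>Inr w\<close> and
      \<open>Inr w'\<close>.\<close>
    with \<open>w \<noteq> w'\<close> have "u \<in> {1..<n} \<or> u' \<in> {1..<n}"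
      by (cases u; cases u') auto
    then show ?thesis
      using u \<open>w \<noteq> w'\<close> eq1 by (metis imageI)
  qed
  have cases: "x \<in> ?S \<or> x = Inl 0 \<or> (\<exists>w<n. x = Inr w)" if "x \<in> pverts ?F" for x
  proof (cases x)
    case (Inl i)
    with that show ?thesis by (cases i) (auto simp: verts)
  next
    case (Inr w)
    with that show ?thesis by (auto simp: verts)
  qed
  have "\<exists>s\<in>?S. graph_dist ?H x s \<noteq> graph_dist ?H y s"
    if x: "x \<in> pverts ?F" and y: "y \<in> pverts ?F" and "x \<noteq> y" for x y
    using cases[OF x] cases[OF y] copy1[of x y] copy1[of y x] mixed copy2 that by metis
  then show ?thesis
    unfolding resolving_set_def by (auto simp: verts)
qed

lemma metric_dimension_functigraph_cycle_graph:
  assumes n: "n \<ge> 3"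
    and f: "bij_betw f (pverts (cycle_graph n)) (pverts (cycle_graph n))"
  shows "2 \<le> metric_dimension (with_proj (functigraph (cycle_graph n) f))" (is "2 \<le> ?dim")
    and "metric_dimension (with_proj (functigraph (cycle_graph n) f)) \<le> n - 1"
proof -
  let ?F = "functigraph (cycle_graph n) f"
  let ?H = "with_proj ?F"
  note res = resolving_set_functigraph_cycle_graph[OF n f]
  have V: "pverts (cycle_graph n) = {..<n}"
    by (simp add: cycle_graph_def)
  have "f ` pverts (cycle_graph n) \<subseteq> pverts (cycle_graph n)"
    using f by (simp add: bij_betw_def)
  then interpret H: pair_graph "functigraph (cycle_graph n) f"
    using pair_graph_functigraph pair_graph_cycle_graph[OF n] by blast
  have verts: "pverts ?F = {..<n} <+> {..<n}"
    by (simp add: functigraph_def V)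
  show "2 \<le> ?dim"
  proof (rule wf_digraph.two_le_metric_dimension[OF H.wf_digraph _ _ res])
    show "verts ?H \<noteq> {}"
      using n by (auto simp: verts lessThan_empty_iff)
    fix s assume "s \<in> verts ?H"
    \<comment> \<open>Surjectivity lets every vertex of the second copy be written
      \<open>Inr (f i)\<close>, which exhibits its neighbour \<open>Inl i\<close>.\<close>
    moreover have "{..<n} = f ` {..<n}"
      using f by (simp add: V bij_betw_def)
    ultimately consider (l) i where "s = Inl i" "i < n" | (r) i where "s = Inr (f i)" "i < n"
      unfolding with_proj_simps verts by blast
    then show "\<exists>x y. x \<noteq> y \<and> x \<noteq> s \<and> y \<noteq> s \<and> x \<rightarrow>\<^bsub>?H\<^esub> s \<and> y \<rightarrow>\<^bsub>?H\<^esub> s"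
    proof cases
      case l
      then show ?thesis
        using cycle_graph_arc_Suc_mod[OF n, of i]
        by (intro exI[of _ "Inl (Suc i mod n)"] exI[of _ "Inr (f i)"])
          (simp only: dominates_functigraph_iff V, simp)
    next
      case r
      moreover have "f i < n"
        using f r by (auto simp: V bij_betw_def)
      ultimately show ?thesis
        using cycle_graph_arc_Suc_mod[OF n, of "f i"]
        by (intro exI[of _ "Inr (Suc (f i) mod n)"] exI[of _ "Inl i"])
          (simp only: dominates_functigraph_iff V, simp)
    qed
  qed simp
  have "card (Inl ` {1..<n} :: (nat + nat) set) = n - 1"
    by (simp add: card_image)
  with metric_dimension_le[OF res] show "?dim \<le> n - 1"
    by simp
qed

theorem theorem4p2:
  shows "(\<forall>(n::nat) \<sigma>. n \<ge> 3 \<longrightarrow> bij_betw \<sigma> (pverts (cycle_graph n)) (pverts (cycle_graph n)) \<longrightarrow>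
            2 \<le> metric_dimension (with_proj (functigraph (cycle_graph n) \<sigma>)) \<and>
            metric_dimension (with_proj (functigraph (cycle_graph n) \<sigma>)) \<le> n - 1)
       \<and> (\<exists>(n::nat) \<sigma>. n \<ge> 3 \<and> bij_betw \<sigma> (pverts (cycle_graph n)) (pverts (cycle_graph n)) \<and>
            metric_dimension (with_proj (functigraph (cycle_graph n) \<sigma>)) = 2)
       \<and> (\<exists>(n::nat) \<sigma>. n \<ge> 3 \<and> bij_betw \<sigma> (pverts (cycle_graph n)) (pverts (cycle_graph n)) \<and>
            metric_dimension (with_proj (functigraph (cycle_graph n) \<sigma>)) = n - 1)"
proof -
  have "bij_betw id (pverts (cycle_graph 3)) (pverts (cycle_graph 3))"
    by simp
  moreover from metric_dimension_functigraph_cycle_graph[OF _ this]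
  have "metric_dimension (with_proj (functigraph (cycle_graph 3) id)) = 2"
    by simp
  \<comment> \<open>The extra conjunct \<open>n - 1 = 2\<close> lets the same witness serve both
    sharpness claims.\<close>
  ultimately have
    "\<exists>(n::nat) \<sigma>. n \<ge> 3 \<and> bij_betw \<sigma> (pverts (cycle_graph n)) (pverts (cycle_graph n)) \<and>
       metric_dimension (with_proj (functigraph (cycle_graph n) \<sigma>)) = 2 \<and> n - 1 = 2"
    by (intro exI[of _ 3] exI[of _ id]) simp
  then show ?thesis
    using metric_dimension_functigraph_cycle_graph by metis
qed

end
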